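(* Let $r_1,s_1,r_2,s_2\ge2$ be integers, let $\boldsymbol{\lambda}=(\lambda_1,\lambda_2)\in(0,\infty)^2$, and put $h_*=\min\{r_1+s_1-1,\,r_2+s_2-1\}$, $e_i=r_i+s_i-2$ for $i\in\{1,2\}$, and $R=\overline{\mathrm{R}}(\mathcal{S}_{r_1,s_1},\mathcal{S}_{r_2,s_2})$. For all integers $R\le t\le n$, $$\overline{\mathrm{M}}_{\boldsymbol{\lambda}}(n;\mathcal{S}_{r_1,s_1},\mathcal{S}_{r_2,s_2})\ \ge\ \overline{\mathrm{M}}_{\boldsymbol{\lambda}}(t;\mathcal{S}_{r_1,s_1},\mathcal{S}_{r_2,s_2})\,\frac{\binom{n}{h_*}}{\binom{t}{h_*}}.$$ Moreover, $$\overline{\mathrm{M}}_{\boldsymbol{\lambda}}(n;\mathcal{S}_{r_1,s_1},\mathcal{S}_{r_2,s_2})\ \le\ \min_{0\le p\le1}\left[\lambda_1p^{e_1}\binom{n}{r_1+s_1-1}+\lambda_2(1-p)^{e_2}\binom{n}{r_2+s_2-1}\right].$$ If in addition $t\ge\max\{r_1+s_1-1,\,r_2+s_2-1\}$, then every red--blue coloring of the edges of $\mathcal{K}_n$ (color $1$ = red, color $2$ = blue) contains, for some $i\in\{1,2\}$, at least $$\frac{\overline{\mathrm{M}}_{\boldsymbol{\lambda}}(t;\mathcal{S}_{r_1,s_1},\mathcal{S}_{r_2,s_2})}{2\lambda_i}\cdot\frac{\binom{n}{r_i+s_i-1}}{\binom{t}{r_i+s_i-1}}$$ copies of $\mathcal{S}_{r_i,s_i}$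 in color $i$.
   Context: An ordered graph is a finite graph with a linear order on its vertex set. $\mathcal{K}_n$ is the complete graph on $[n]=\{1,\ldots,n\}$ with the natural order. For integers $r,s\ge1$, $\mathcal{S}_{r,s}$ is the ordered star whose center has $r-1$ leaves to its left (preceding it) and $s-1$ leaves to its right (following it); it has $r+s-1$ vertices. An order-preserving copy of an ordered graph $\mathcal{H}$ in $\mathcal{G}$ is an injective map $V(\mathcal{H})\to V(\mathcal{G})$ that preserves the vertex order and maps every edge of $\mathcal{H}$ to an edge of $\mathcal{G}$; copies are counted by their vertex sets (an $h$-element vertex set supports at most one copy of a fixed $h$-vertex ordered graph). For ordered graphs $\mathcal{G}_1,\mathcal{G}_2$ and a coloring $\chi:E(\mathcal{K}_n)\to\{1,2\}$, $N_i(\chi;\mathcal{G}_i)$ is the number of order-preserving copies of $\mathcal{G}_i$ in $\mathcal{K}_n$ all of whose edges have color $i$. $\overline{\mathrm{R}}(\mathcal{G}_1,\mathcal{G}_2)$ is the least $N$ such that every $\chi:E(\mathcal{K}_N)\to\{1,2\}$ contains an order-preserving copy of $\mathcal{G}_i$ in color $i$ for some $i\in\{1,2\}$. The weighted ordered multiplicity is $$\overline{\mathrm{M}}_{\boldsymbol{\lambda}}(n;\mathcal{G}_1,\mathcal{G}_2)=\min_{\chi:E(\mathcal{K}_n)\to\{1,2\}}\bigl(\lambda_1N_1(\chi;\mathcal{G}_1)+\lambda_2N_2(\chi;\mathcal{G}_2)\bigr).$$ Convention: $\binom{x}{q}=0$ when $q<0$ or $q>x$. *)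

theory Defs
  imports Complex_Main "HOL-Library.Ramsey"
begin

record 'a ograph =
  overts :: "'a set"
  oedges :: "'a set set"

text \<open>The linear order on the vertices is the one of the ambient linearly ordered type.\<close>

definition ordered_graph :: "'a::linorder ograph \<Rightarrow> bool" where
  "ordered_graph G \<longleftrightarrow> finite (overts G) \<and> oedges G \<subseteq> nsets (overts G) 2"

definition complete_ograph :: "nat \<Rightarrow> nat ograph" where
  "complete_ograph n = \<lparr>overts = {1..n}, oedges = nsets {1..n} 2\<rparr>"

text \<open>The centre is the vertex \<open>r\<close>: the leaves \<open>1, \<dots>, r - 1\<close> precede it and the
  leaves \<open>r + 1, \<dots>, r + s - 1\<close> follow it.\<close>

definition ordered_star :: "nat \<Rightarrow> nat \<Rightarrow> nat ograph" where
  "ordered_star r s =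
     \<lparr>overts = {1..r + s - 1}, oedges = {{r, j} |j. j \<in> {1..r + s - 1} - {r}}\<rparr>"

definition order_embedding :: "('a::linorder \<Rightarrow> 'b::linorder) \<Rightarrow> 'a ograph \<Rightarrow> 'b ograph \<Rightarrow> bool" where
  "order_embedding f H G \<longleftrightarrow>
     f ` overts H \<subseteq> overts G \<and> strict_mono_on (overts H) f \<and> (\<forall>e\<in>oedges H. f ` e \<in> oedges G)"

text \<open>Colourings are extensional functions, so that there are only finitely many of them.\<close>

definition colourings :: "nat \<Rightarrow> (nat set \<Rightarrow> nat) set" where
  "colourings n = oedges (complete_ograph n) \<rightarrow>\<^sub>E {1, 2}"

text \<open>A copy is represented by its vertex set.\<close>

definition mono_copies ::
    "nat \<Rightarrow> (nat set \<Rightarrow> nat) \<Rightarrow> nat \<Rightarrow> 'a::linorder ograph \<Rightarrow> nat set set" where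
  "mono_copies n \<chi> i H =
     {f ` overts H |f. order_embedding f H (complete_ograph n) \<and> (\<forall>e\<in>oedges H. \<chi> (f ` e) = i)}"

definition num_copies :: "nat \<Rightarrow> (nat set \<Rightarrow> nat) \<Rightarrow> nat \<Rightarrow> 'a::linorder ograph \<Rightarrow> nat" where
  "num_copies n \<chi> i H = card (mono_copies n \<chi> i H)"

definition ordered_ramsey :: "'a::linorder ograph \<Rightarrow> 'b::linorder ograph \<Rightarrow> nat" where
  "ordered_ramsey G1 G2 =
     (LEAST N. \<forall>\<chi>\<in>colourings N. mono_copies N \<chi> 1 G1 \<noteq> {} \<or> mono_copies N \<chi> 2 G2 \<noteq> {})"

definition ordered_mult ::
    "real \<Rightarrow> real \<Rightarrow> nat \<Rightarrow> 'a::linorder ograph \<Rightarrow> 'b::linorder ograph \<Rightarrow> real" where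
  "ordered_mult lam1 lam2 n G1 G2 =
     Min ((\<lambda>\<chi>. lam1 * real (num_copies n \<chi> 1 G1) + lam2 * real (num_copies n \<chi> 2 G2))
            ` colourings n)"

lemma ordered_graph_complete: "ordered_graph (complete_ograph n)"
  by (simp add: ordered_graph_def complete_ograph_def)

lemma ordered_graph_star:
  assumes "r \<ge> 1" "s \<ge> 1"
  shows "ordered_graph (ordered_star r s)"
  using assms by (auto simp: ordered_graph_def ordered_star_def nsets_def)

lemma finite_colourings: "finite (colourings n)"
  by (auto simp: colourings_def complete_ograph_def intro!: finite_PiE finite_imp_finite_nsets)

lemma colourings_nonempty: "colourings n \<noteq> {}"
  by (simp add: colourings_def PiE_eq_empty_iff)

end

(* Both bounds are averaging arguments, and neither uses the star shape beyond its numbers of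
   vertices and edges. For the lower bounds, restrict a colouring of K_n to every t-subset,
   where its weighted count is at least the multiplicity at t. A copy on h vertices lies in
   (n - h choose t - h) of these subsets, and dividing by (n choose t) gives
     M(t) <= lam1 N1 (t choose h1)/(n choose h1) + lam2 N2 (t choose h2)/(n choose h2).
   The ratio (t choose h)/(n choose h) decreases in h, which gives the first claim; one of the
   two summands is at least M(t)/2, which gives the third. For the upper bound, colour the edges
   independently, with colour 1 having probability p, and compare the minimum with the mean. *)
theory Submission
  imports Defs
begin

section \<open>Order-preserving maps and binomial ratios\<close>

text \<open>A strictly increasing map carries the sorted list of \<open>A\<close> to the sorted list
  of its image, so the image fixes the map entry by entry. Hence a vertex set carries at most one
  embedding of a finite ordered graph, which allows copies to be identified with vertex
  sets.\<close>

lemma strict_mono_on_image_unique: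
  fixes f g :: "'a::linorder \<Rightarrow> 'b::linorder"
  assumes "finite A" "strict_mono_on A f" "strict_mono_on A g" "f ` A = g ` A" "x \<in> A"
  shows "f x = g x"
proof -
  have sorted: "sorted_list_of_set (k ` A) = map k (sorted_list_of_set A)"
    if "strict_mono_on A k" for k :: "'a \<Rightarrow> 'b"
  proof (rule sorted_distinct_set_unique)
    show "sorted (map k (sorted_list_of_set A))"
      unfolding sorted_map
      by (rule sorted_wrt_mono_rel[OF _ sorted_sorted_list_of_set])
         (use that \<open>finite A\<close> in \<open>auto intro: strict_mono_on_leD\<close>)
    show "distinct (map k (sorted_list_of_set A))"
      using that \<open>finite A\<close> by (simp add: distinct_map strict_mono_on_imp_inj_on)
  qed (use \<open>finite A\<close> in auto)
  have "map f (sorted_list_of_set A) = map g (sorted_list_of_set A)"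
    using sorted[OF assms(2)] sorted[OF assms(3)] assms(4) by simp
  then show ?thesis
    using assms(1,5) by simp
qed

text \<open>Shifts the increasing enumeration by \<open>{..<card T}\<close> to start at 1, so that
  its domain is the vertex set of a complete graph.\<close>

lemma ex_strict_mono_enumeration:
  fixes T :: "nat set"
  assumes "finite T"
  obtains \<phi> where "strict_mono_on {1..card T} \<phi>" "\<phi> ` {1..card T} = T"
proof -
  obtain k where k: "bij_betw k {..<card T} T" "strict_mono_on {..<card T} k"
    using ex_bij_betw_strict_mono_card[OF assms] .
  have shift: "(\<lambda>i. i - 1) ` {1..card T} = {..<card T}"
    by (auto simp: image_iff intro!: bexI[of _ "Suc _"])
  show thesis
  proof
    show "strict_mono_on {1..card T} (\<lambda>i. k (i - 1))"
      by (rule strict_mono_onI, rule strict_mono_onD[OF k(2)]) auto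
    have "(\<lambda>i. k (i - 1)) ` {1..card T} = k ` (\<lambda>i. i - 1) ` {1..card T}"
      by (rule image_image[symmetric])
    then show "(\<lambda>i. k (i - 1)) ` {1..card T} = T"
      using k(1) by (simp only: bij_betw_def shift)
  qed
qed

text \<open>Removing \<open>V\<close> matches these supersets with the subsets of
  \<open>A - V\<close> of size \<open>t - card V\<close>. The bound \<open>card V \<le> t\<close>
  matters because truncated subtraction would otherwise give 1 for an empty family.\<close>

lemma card_supersets:
  assumes "finite A" "V \<subseteq> A" "card V \<le> t"
  shows "card {T \<in> nsets A t. V \<subseteq> T} = (card A - card V) choose (t - card V)"
proof -
  have fin: "finite V"
    using assms finite_subset by blast
  have "bij_betw (\<lambda>S. S \<union> V) (nsets (A - V) (t - card V)) {T \<in> nsets A t. V \<subseteq> T}"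
  proof (rule bij_betwI[where g = "\<lambda>T. T - V"])
    show "(\<lambda>S. S \<union> V) \<in> nsets (A - V) (t - card V) \<rightarrow> {T \<in> nsets A t. V \<subseteq> T}"
    proof
      fix S assume "S \<in> nsets (A - V) (t - card V)"
      then have S: "S \<subseteq> A - V" "finite S" "card S = t - card V"
        by (auto simp: nsets_def)
      then have "card (S \<union> V) = t"
        using assms fin by (subst card_Un_disjoint) auto
      then show "S \<union> V \<in> {T \<in> nsets A t. V \<subseteq> T}"
        using S assms fin by (auto simp: nsets_def)
    qed
    show "(\<lambda>T. T - V) \<in> {T \<in> nsets A t. V \<subseteq> T} \<rightarrow> nsets (A - V) (t - card V)"
      using fin by (auto simp: nsets_def card_Diff_subset)
  qed (auto simp: nsets_def)
  then have "card {T \<in> nsets A t. V \<subseteq> T} = card (nsets (A - V) (t - card V))"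
    using bij_betw_same_card[symmetric] by blast
  then show ?thesis
    using fin assms by (simp add: card_Diff_subset)
qed

text \<open>Double counting of nested pairs of an \<open>h\<close>-set inside a
  \<open>t\<close>-set. The right side is the fraction of \<open>t\<close>-subsets of an
  \<open>n\<close>-set that contain a fixed \<open>h\<close>-subset.\<close>

lemma binomial_ratio:
  assumes "h \<le> t" "t \<le> n"
  shows "real (t choose h) / real (n choose h)
    = real ((n - h) choose (t - h)) / real (n choose t)"
proof -
  have "real (n choose t) * real (t choose h) = real (n choose h) * real ((n - h) choose (t - h))"
    using choose_mult[OF assms] by (metis of_nat_mult)
  then show ?thesis
    using assms by (simp add: field_simps)
qed

text \<open>For \<open>k \<le> t\<close> the ratio is the fraction of \<open>t\<close>-sets
  containing a fixed set, and fewer of them contain a larger one. For \<open>k > t\<close> the left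
  side is 0.\<close>

lemma binomial_ratio_antimono:
  assumes "h \<le> k" "t \<le> n"
  shows "real (t choose k) / real (n choose k) \<le> real (t choose h) / real (n choose h)"
proof (cases "k \<le> t")
  case True
  have "(n - k) choose (t - k) \<le> (n - h) choose (t - h)"
    using \<open>h \<le> k\<close> True
  proof (induction k rule: dec_induct)
    case (step m)
    \<comment> \<open>Pascal's rule; \<open>m < t \<le> n\<close> makes both differences
      positive.\<close>
    have "(n - m) choose (t - m) = ((n - Suc m) choose (t - Suc m)) + ((n - Suc m) choose (t - m))"
      using step assms
      by (metis Suc_diff_Suc Suc_le_lessD add.commute binomial_Suc_Suc order.strict_trans2)
    then show ?case
      using step by simp
  qed simp
  then show ?thesis
    using True assms by (simp add: binomial_ratio divide_right_mono)
qed (simp add: binomial_eq_0)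

section \<open>Monochromatic copies and the attained minimum\<close>

lemma mono_copies_subset_nsets:
  assumes "finite (overts H)"
  shows "mono_copies n \<chi> i H \<subseteq> nsets {1..n} (card (overts H))"
  using assms
  by (auto simp: mono_copies_def order_embedding_def complete_ograph_def nsets_def
      intro!: card_image strict_mono_on_imp_inj_on)

lemma finite_mono_copies:
  assumes "finite (overts H)"
  shows "finite (mono_copies n \<chi> i H)"
  using mono_copies_subset_nsets[OF assms] by (rule finite_subset) (simp add: finite_imp_finite_nsets)

lemma ordered_mult_le:
  assumes "\<chi> \<in> colourings n"
  shows "ordered_mult lam1 lam2 n G H
    \<le> lam1 * real (num_copies n \<chi> 1 G) + lam2 * real (num_copies n \<chi> 2 H)"
  unfolding ordered_mult_def using assms by (intro Min_le) (auto simp: finite_colourings)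

lemma ordered_mult_attained:
  obtains \<chi> where "\<chi> \<in> colourings n"
    "ordered_mult lam1 lam2 n G H
      = lam1 * real (num_copies n \<chi> 1 G) + lam2 * real (num_copies n \<chi> 2 H)"
proof -
  have "ordered_mult lam1 lam2 n G H
    \<in> (\<lambda>\<chi>. lam1 * real (num_copies n \<chi> 1 G) + lam2 * real (num_copies n \<chi> 2 H)) ` colourings n"
    unfolding ordered_mult_def
    by (intro Min_in) (simp_all add: finite_colourings colourings_nonempty)
  then show thesis
    using that by blast
qed

section \<open>Restriction of a colouring to a vertex subset\<close>

text \<open>The colouring induced on the image of \<open>\<phi>\<close>, relabelled by
  \<open>{1..t}\<close>. The restricted abstraction makes it extensional, as membership in
  \<open>colourings t\<close> demands.\<close>

definition pullback_colouring :: "nat \<Rightarrow> (nat \<Rightarrow> nat) \<Rightarrow> (nat set \<Rightarrow> nat) \<Rightarrow> nat set \<Rightarrow> nat" where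
  "pullback_colouring t \<phi> \<chi> = (\<lambda>e\<in>nsets {1..t} 2. \<chi> (\<phi> ` e))"

lemma pullback_colouring_in:
  assumes "\<chi> \<in> colourings n" "strict_mono_on {1..t} \<phi>" "\<phi> ` {1..t} \<subseteq> {1..n}"
  shows "pullback_colouring t \<phi> \<chi> \<in> colourings t"
proof -
  have "\<phi> ` e \<in> nsets {1..n} 2" if "e \<in> nsets {1..t} 2" for e
    using that assms nsets_image_funcset[of \<phi> "{1..t}" "{1..n}" 2]
    by (auto simp: strict_mono_on_imp_inj_on image_subset_iff_funcset)
  then show ?thesis
    using assms(1) by (auto simp: colourings_def complete_ograph_def pullback_colouring_def)
qed

text \<open>Composing an embedding with \<open>\<phi>\<close> gives a copy of the same colour inside
  the image of \<open>\<phi>\<close>. On vertex sets this is the image map, which is injective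
  because \<open>\<phi>\<close> is.\<close>

lemma num_copies_pullback_le:
  assumes H: "finite (overts H)"
    and \<phi>: "strict_mono_on {1..t} \<phi>" "\<phi> ` {1..t} \<subseteq> {1..n}"
  shows "num_copies t (pullback_colouring t \<phi> \<chi>) i H
    \<le> card {V \<in> mono_copies n \<chi> i H. V \<subseteq> \<phi> ` {1..t}}"
  unfolding num_copies_def
proof (rule card_inj_on_le[where f = "(`) \<phi>"])
  let ?C = "mono_copies t (pullback_colouring t \<phi> \<chi>) i H"
  have inj: "inj_on \<phi> {1..t}"
    using \<phi>(1) by (rule strict_mono_on_imp_inj_on)
  show "inj_on ((`) \<phi>) ?C"
    using inj_on_image_Pow[OF inj] by (rule inj_on_subset)
      (use mono_copies_subset_nsets[OF H, of t] in \<open>fastforce simp: nsets_def\<close>)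
  show "(`) \<phi> ` ?C \<subseteq> {V \<in> mono_copies n \<chi> i H. V \<subseteq> \<phi> ` {1..t}}"
  proof
    fix W assume "W \<in> (`) \<phi> ` ?C"
    then obtain f where f: "W = \<phi> ` f ` overts H" "order_embedding f H (complete_ograph t)"
      "\<forall>e\<in>oedges H. pullback_colouring t \<phi> \<chi> (f ` e) = i"
      by (auto simp: mono_copies_def)
    have verts: "f ` overts H \<subseteq> {1..t}" and f_mono: "strict_mono_on (overts H) f"
      and edges: "\<And>e. e \<in> oedges H \<Longrightarrow> f ` e \<in> nsets {1..t} 2"
      using f(2) by (auto simp: order_embedding_def complete_ograph_def)
    have "order_embedding (\<phi> \<circ> f) H (complete_ograph n)"
      unfolding order_embedding_def
    proof (intro conjI ballI)
      show "(\<phi> \<circ> f) ` overts H \<subseteq> overts (complete_ograph n)"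
        using verts \<phi>(2) by (fastforce simp: complete_ograph_def)
      show "strict_mono_on (overts H) (\<phi> \<circ> f)"
      proof (rule strict_mono_onI)
        fix x y assume "x \<in> overts H" "y \<in> overts H" "x < y"
        then show "(\<phi> \<circ> f) x < (\<phi> \<circ> f) y"
          using strict_mono_onD[OF \<phi>(1)] strict_mono_onD[OF f_mono] verts
          by (simp add: image_subset_iff)
      qed
      have "(`) \<phi> \<in> nsets {1..t} 2 \<rightarrow> nsets {1..n} 2"
        using \<phi>(2) inj by (intro nsets_image_funcset) auto
      then show "(\<phi> \<circ> f) ` e \<in> oedges (complete_ograph n)" if "e \<in> oedges H" for e
        unfolding complete_ograph_def image_comp[symmetric] ograph.simps
        using funcset_mem edges[OF that] by metis
    qed
    moreover have "\<chi> ((\<phi> \<circ> f) ` e) = i" if "e \<in> oedges H" for e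
      using f(3) edges[OF that] that unfolding image_comp[symmetric]
      by (auto simp: pullback_colouring_def simp del: image_comp)
    moreover have "W = (\<phi> \<circ> f) ` overts H"
      using f(1) by (simp add: image_comp)
    ultimately have "W \<in> mono_copies n \<chi> i H"
      unfolding mono_copies_def by blast
    then show "W \<in> {V \<in> mono_copies n \<chi> i H. V \<subseteq> \<phi> ` {1..t}}"
      using verts f(1) by (simp add: image_mono)
  qed
qed (use finite_mono_copies[OF H] in simp)

text \<open>Enumerated in increasing order, \<open>T\<close> is a copy of the complete graph on
  \<open>t\<close> vertices, and the induced colouring has weighted count at least the
  minimum.\<close>

lemma ordered_mult_le_subset:
  assumes G: "finite (overts G)" and H: "finite (overts H)"
    and "lam1 \<ge> 0" "lam2 \<ge> 0" and \<chi>: "\<chi> \<in> colourings n" and T: "T \<in> nsets {1..n} t"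
  shows "ordered_mult lam1 lam2 t G H
    \<le> lam1 * real (card {V \<in> mono_copies n \<chi> 1 G. V \<subseteq> T})
      + lam2 * real (card {V \<in> mono_copies n \<chi> 2 H. V \<subseteq> T})"
proof -
  have T': "finite T" "card T = t" "T \<subseteq> {1..n}"
    using T by (auto simp: nsets_def)
  then obtain \<phi> where \<phi>: "strict_mono_on {1..t} \<phi>" "\<phi> ` {1..t} = T"
    using ex_strict_mono_enumeration by metis
  let ?\<chi> = "pullback_colouring t \<phi> \<chi>"
  have "ordered_mult lam1 lam2 t G H
    \<le> lam1 * real (num_copies t ?\<chi> 1 G) + lam2 * real (num_copies t ?\<chi> 2 H)"
    using pullback_colouring_in[OF \<chi> \<phi>(1)] \<phi>(2) T' by (intro ordered_mult_le) simp
  also have "\<dots> \<le> lam1 * real (card {V \<in> mono_copies n \<chi> 1 G. V \<subseteq> T})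
      + lam2 * real (card {V \<in> mono_copies n \<chi> 2 H. V \<subseteq> T})"
    using num_copies_pullback_le[OF G \<phi>(1), of n \<chi> 1] num_copies_pullback_le[OF H \<phi>(1), of n \<chi> 2]
      \<phi>(2) T' assms(3,4)
    by (intro add_mono mult_left_mono) auto
  finally show ?thesis .
qed

section \<open>Averaging over all \<open>t\<close>-subsets\<close>

text \<open>Pairs of a copy \<open>V\<close> and a \<open>t\<close>-set \<open>T\<close> containing
  it are counted in both orders; every \<open>V\<close> lies in equally many \<open>T\<close>. When
  copies have more than \<open>t\<close> vertices, both sides are 0.\<close>

lemma sum_copies_in_subsets:
  assumes H: "finite (overts H)" and "t \<le> n"
  shows "(\<Sum>T\<in>nsets {1..n} t. real (card {V \<in> mono_copies n \<chi> i H. V \<subseteq> T}))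
    = real (n choose t) * (real (num_copies n \<chi> i H)
        * (real (t choose card (overts H)) / real (n choose card (overts H))))"
proof -
  let ?C = "mono_copies n \<chi> i H" and ?h = "card (overts H)"
  have fin: "finite ?C" "finite (nsets {1..n} t)"
    using H by (simp_all add: finite_mono_copies finite_imp_finite_nsets)
  have C: "V \<subseteq> {1..n}" "card V = ?h" if "V \<in> ?C" for V
    using subsetD[OF mono_copies_subset_nsets[OF H] that] by (auto simp: nsets_def)
  have supersets: "real (card {T \<in> nsets {1..n} t. V \<subseteq> T})
      = real (n choose t) * (real (t choose ?h) / real (n choose ?h))" if "V \<in> ?C" for V
  proof (cases "?h \<le> t")
    case True
    then show ?thesis
      using card_supersets[of "{1..n}" V t] C[OF that] \<open>t \<le> n\<close> by (simp add: binomial_ratio)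
  next
    case False
    then have "{T \<in> nsets {1..n} t. V \<subseteq> T} = {}"
      using C(2)[OF that] by (auto simp: nsets_def dest: card_mono)
    then have "card {T \<in> nsets {1..n} t. V \<subseteq> T} = 0"
      by (metis card.empty)
    then show ?thesis
      using False by (simp add: binomial_eq_0)
  qed
  have "(\<Sum>T\<in>nsets {1..n} t. card {V \<in> ?C. V \<subseteq> T}) = (\<Sum>V\<in>?C. card {T \<in> nsets {1..n} t. V \<subseteq> T})"
    using fin by (intro sum_multicount_gen) auto
  then have "(\<Sum>T\<in>nsets {1..n} t. real (card {V \<in> ?C. V \<subseteq> T}))
      = (\<Sum>V\<in>?C. real (card {T \<in> nsets {1..n} t. V \<subseteq> T}))"
    by (simp only: flip: of_nat_sum)
  also have "\<dots> = (\<Sum>V\<in>?C. real (n choose t) * (real (t choose ?h) / real (n choose ?h)))"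
    by (intro sum.cong refl supersets)
  finally show ?thesis
    by (simp add: num_copies_def)
qed

text \<open>Sum the bound for a single \<open>T\<close> over all \<open>T\<close>, then cancel
  \<open>n choose t\<close>, which is positive since \<open>t \<le> n\<close>.\<close>

lemma ordered_mult_le_averaged:
  assumes G: "finite (overts G)" and H: "finite (overts H)"
    and lam: "lam1 \<ge> 0" "lam2 \<ge> 0" and "t \<le> n" and \<chi>: "\<chi> \<in> colourings n"
  shows "ordered_mult lam1 lam2 t G H
    \<le> lam1 * (real (num_copies n \<chi> 1 G)
        * (real (t choose card (overts G)) / real (n choose card (overts G))))
      + lam2 * (real (num_copies n \<chi> 2 H)
        * (real (t choose card (overts H)) / real (n choose card (overts H))))"
    (is "?M \<le> lam1 * ?a + lam2 * ?b")
proof -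
  have "real (n choose t) * ?M = (\<Sum>T\<in>nsets {1..n} t. ?M)"
    by simp
  also have "\<dots> \<le> (\<Sum>T\<in>nsets {1..n} t. lam1 * real (card {V \<in> mono_copies n \<chi> 1 G. V \<subseteq> T})
      + lam2 * real (card {V \<in> mono_copies n \<chi> 2 H. V \<subseteq> T}))"
    by (intro sum_mono ordered_mult_le_subset G H lam \<chi>)
  also have "\<dots> = lam1 * (real (n choose t) * ?a) + lam2 * (real (n choose t) * ?b)"
    by (simp only: sum.distrib sum_distrib_left[symmetric]
        sum_copies_in_subsets[OF G \<open>t \<le> n\<close>] sum_copies_in_subsets[OF H \<open>t \<le> n\<close>])
  also have "\<dots> = real (n choose t) * (lam1 * ?a + lam2 * ?b)"
    by (simp only: distrib_left mult.left_commute)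
  finally show ?thesis
    by (rule mult_left_le_imp_le) (use \<open>t \<le> n\<close> in simp)
qed

text \<open>Apply the averaged bound to an optimal colouring at \<open>n\<close>. By antitonicity
  both ratios are at most the one for the smaller order \<open>h\<close>, which then factors
  out.\<close>

lemma ordered_mult_growth:
  assumes G: "finite (overts G)" and H: "finite (overts H)"
    and lam: "lam1 \<ge> 0" "lam2 \<ge> 0" and "t \<le> n"
    and h: "h = min (card (overts G)) (card (overts H))"
  shows "ordered_mult lam1 lam2 t G H * (real (n choose h) / real (t choose h))
    \<le> ordered_mult lam1 lam2 n G H"
proof -
  obtain \<chi> where \<chi>: "\<chi> \<in> colourings n"
    and M: "ordered_mult lam1 lam2 n G H
      = lam1 * real (num_copies n \<chi> 1 G) + lam2 * real (num_copies n \<chi> 2 H)"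
    by (rule ordered_mult_attained)
  let ?q = "real (t choose h) / real (n choose h)"
  have "ordered_mult lam1 lam2 t G H
      \<le> lam1 * (real (num_copies n \<chi> 1 G) * ?q) + lam2 * (real (num_copies n \<chi> 2 H) * ?q)"
    by (rule order.trans[OF ordered_mult_le_averaged[OF G H lam \<open>t \<le> n\<close> \<chi>]])
       (intro add_mono mult_left_mono binomial_ratio_antimono; use h lam \<open>t \<le> n\<close> in simp)
  also have "\<dots> = ordered_mult lam1 lam2 n G H * ?q"
    unfolding M by (simp only: distrib_right mult.assoc)
  finally have le: "ordered_mult lam1 lam2 t G H \<le> ordered_mult lam1 lam2 n G H * ?q" .
  have nonneg: "ordered_mult lam1 lam2 n G H \<ge> 0"
    unfolding M using lam by simp
  show ?thesis
  \<comment> \<open>If \<open>h > t\<close>, then \<open>t choose h\<close> is 0 and division by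
    zero gives 0, so the claim reduces to nonnegativity of the multiplicity.\<close>
  proof (cases "h \<le> t")
    case True
    then have "real (t choose h) > 0" "real (n choose h) > 0"
      using \<open>t \<le> n\<close> by simp_all
    then show ?thesis
      using le by (simp add: field_simps)
  qed (use nonneg in \<open>simp add: binomial_eq_0\<close>)
qed

text \<open>In the averaged bound one of the two summands is at least half of the multiplicity at
  \<open>t\<close>; solving for its copy count gives the claim.\<close>

lemma many_copies_in_one_colour:
  assumes G: "finite (overts G)" and H: "finite (overts H)"
    and lam: "lam1 > 0" "lam2 > 0" and "t \<le> n" and \<chi>: "\<chi> \<in> colourings n"
    and t: "card (overts G) \<le> t" "card (overts H) \<le> t"
  shows "ordered_mult lam1 lam2 t G H / (2 * lam1)
        * (real (n choose card (overts G)) / real (t choose card (overts G)))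
      \<le> real (num_copies n \<chi> 1 G)
    \<or> ordered_mult lam1 lam2 t G H / (2 * lam2)
        * (real (n choose card (overts H)) / real (t choose card (overts H)))
      \<le> real (num_copies n \<chi> 2 H)"
proof -
  let ?M = "ordered_mult lam1 lam2 t G H"
  \<comment> \<open>Clearing the ratio requires \<open>t choose k\<close> to be nonzero, hence
    \<open>k \<le> t\<close>.\<close>
  have solve: "?M / (2 * l) * (real (n choose k) / real (t choose k)) \<le> N"
    if "?M / 2 \<le> l * (N * (real (t choose k) / real (n choose k)))" "l > 0" "k \<le> t" for l N k
  proof -
    have "real (t choose k) > 0" "real (n choose k) > 0"
      using that \<open>t \<le> n\<close> by simp_all
    then show ?thesis
      using that by (simp add: field_simps)
  qed
  have "?M / 2 \<le> lam1 * (real (num_copies n \<chi> 1 G)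
        * (real (t choose card (overts G)) / real (n choose card (overts G))))
    \<or> ?M / 2 \<le> lam2 * (real (num_copies n \<chi> 2 H)
        * (real (t choose card (overts H)) / real (n choose card (overts H))))"
    using ordered_mult_le_averaged[OF G H _ _ \<open>t \<le> n\<close> \<chi>, of lam1 lam2] lam by linarith
  then show ?thesis
    using solve lam t by blast
qed

section \<open>Random colourings\<close>

text \<open>The probability of \<open>\<chi>\<close> when each edge independently gets colour 1 with
  probability \<open>p\<close> and colour 2 otherwise. Expectations become finite weighted sums over
  \<open>colourings n\<close>.\<close>

definition random_weight :: "real \<Rightarrow> nat \<Rightarrow> (nat set \<Rightarrow> nat) \<Rightarrow> real" where
  "random_weight p n \<chi> = (\<Prod>e\<in>nsets {1..n} 2. if \<chi> e = 1 then p else 1 - p)"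

lemma random_weight_nonneg:
  assumes "0 \<le> p" "p \<le> 1"
  shows "random_weight p n \<chi> \<ge> 0"
  unfolding random_weight_def using assms by (intro prod_nonneg) auto

text \<open>The probability that all edges in \<open>F\<close> receive colour \<open>c\<close>, by
  independence.\<close>

lemma random_weight_monochromatic:
  assumes F: "F \<subseteq> nsets {1..n} 2" and c: "c \<in> {1, 2}"
  shows "(\<Sum>\<chi>\<in>colourings n. if \<forall>e\<in>F. \<chi> e = c then random_weight p n \<chi> else 0)
    = (if c = 1 then p else 1 - p) ^ card F"
proof -
  let ?E = "nsets {1..n::nat} 2"
  let ?q = "\<lambda>d::nat. if d = 1 then p else 1 - p"
  \<comment> \<open>Putting the indicator into the factors keeps the summand a product over edges,
    so the sum over colourings factorises. An edge of \<open>F\<close> then contributes the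
    probability of \<open>c\<close>, any other edge \<open>p + (1 - p) = 1\<close>.\<close>
  let ?g = "\<lambda>e d. if e \<in> F \<and> d \<noteq> c then 0 else ?q d"
  have fin: "finite ?E"
    by (simp add: finite_imp_finite_nsets)
  have "(if \<forall>e\<in>F. \<chi> e = c then random_weight p n \<chi> else 0) = (\<Prod>e\<in>?E. ?g e (\<chi> e))" for \<chi>
  proof (cases "\<forall>e\<in>F. \<chi> e = c")
    case True
    then show ?thesis
      unfolding random_weight_def by (auto intro!: prod.cong)
  next
    case False
    then obtain e where "e \<in> F" "\<chi> e \<noteq> c"
      by blast
    then have "(\<Prod>e\<in>?E. ?g e (\<chi> e)) = 0"
      using fin F by (intro prod_zero) auto
    then show ?thesis
      by (simp only: if_not_P[OF False])
  qed
  then have "(\<Sum>\<chi>\<in>colourings n. if \<forall>e\<in>F. \<chi> e = c then random_weight p n \<chi> else 0)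
      = (\<Sum>\<chi>\<in>?E \<rightarrow>\<^sub>E {1, 2}. \<Prod>e\<in>?E. ?g e (\<chi> e))"
    by (simp add: colourings_def complete_ograph_def)
  also have "\<dots> = (\<Prod>e\<in>?E. \<Sum>d\<in>{1, 2}. ?g e d)"
    using fin by (intro prod_sum_PiE[symmetric]) auto
  also have "\<dots> = (\<Prod>e\<in>?E. if e \<in> F then ?q c else 1)"
    using c by (intro prod.cong) auto
  also have "\<dots> = (\<Prod>e\<in>F. ?q c)"
    using fin F by (simp add: prod.inter_restrict[symmetric] Int_absorb1)
  finally show ?thesis
    by simp
qed

lemma sum_random_weight: "(\<Sum>\<chi>\<in>colourings n. random_weight p n \<chi>) = 1"
  using random_weight_monochromatic[of "{}" n 1 p] by simp

text \<open>Linearity of expectation over the candidate vertex sets: each is a copy in colour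
  \<open>c\<close> with probability at most that of its fixed image edges all having colour
  \<open>c\<close>.\<close>

lemma expected_num_copies_le:
  fixes H :: "'a::linorder ograph"
  assumes H: "ordered_graph H" and c: "c \<in> {1, 2}" and p: "0 \<le> p" "p \<le> 1"
  shows "(\<Sum>\<chi>\<in>colourings n. random_weight p n \<chi> * real (num_copies n \<chi> c H))
    \<le> (if c = 1 then p else 1 - p) ^ card (oedges H) * real (n choose card (overts H))"
    (is "_ \<le> ?q ^ _ * _")
proof -
  have finH: "finite (overts H)" and edgesH: "oedges H \<subseteq> Pow (overts H)"
    using H by (auto simp: ordered_graph_def nsets_def)
  let ?S = "nsets {1..n} (card (overts H))"
  let ?w = "random_weight p n"
  have finS: "finite ?S"
    by (simp add: finite_imp_finite_nsets)
  \<comment> \<open>The index set \<open>?S\<close> does not depend on \<open>\<chi>\<close>, so the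
    two sums can be swapped later.\<close>
  have expand: "?w \<chi> * real (num_copies n \<chi> c H)
      = (\<Sum>V\<in>?S. if V \<in> mono_copies n \<chi> c H then ?w \<chi> else 0)" for \<chi>
    using finS mono_copies_subset_nsets[OF finH, of n \<chi> c]
    by (simp add: num_copies_def sum.inter_restrict[symmetric] Int_absorb1)
  have each: "(\<Sum>\<chi>\<in>colourings n. if V \<in> mono_copies n \<chi> c H then ?w \<chi> else 0)
      \<le> ?q ^ card (oedges H)" for V
  proof (cases "\<exists>f. order_embedding f H (complete_ograph n) \<and> V = f ` overts H")
    case False
    then have "V \<notin> mono_copies n \<chi> c H" for \<chi>
      by (auto simp: mono_copies_def)
    then show ?thesis
      using p by simp
  next
    case True
    then obtain f where f: "order_embedding f H (complete_ograph n)" "V = f ` overts H"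
      by blast
    then have mono: "strict_mono_on (overts H) f"
      by (simp add: order_embedding_def)
    let ?F = "(`) f ` oedges H"
    have F: "?F \<subseteq> nsets {1..n} 2"
      using f by (auto simp: order_embedding_def complete_ograph_def)
    have "inj_on ((`) f) (oedges H)"
      using inj_on_image_Pow[OF strict_mono_on_imp_inj_on[OF mono]] edgesH by (rule inj_on_subset)
    then have cardF: "card ?F = card (oedges H)"
      by (rule card_image)
    \<comment> \<open>\<open>f\<close> was chosen before \<open>\<chi>\<close>. Any embedding
      \<open>g\<close> witnessing a copy on \<open>V\<close> agrees with \<open>f\<close> on the
      vertices, so the same edges \<open>?F\<close> serve for every colouring.\<close>
    have coloured: "\<forall>e\<in>?F. \<chi> e = c" if V: "V \<in> mono_copies n \<chi> c H" for \<chi>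
    proof -
      obtain g where g: "V = g ` overts H" "order_embedding g H (complete_ograph n)"
        "\<forall>e\<in>oedges H. \<chi> (g ` e) = c"
        using V by (auto simp: mono_copies_def)
      then have "g x = f x" if "x \<in> overts H" for x
        using strict_mono_on_image_unique[OF finH _ mono _ that, of g] f(2)
        by (simp add: order_embedding_def)
      then have "g ` e = f ` e" if "e \<in> oedges H" for e
        using edgesH that by (intro image_cong) auto
      then show ?thesis
        using g(3) by auto
    qed
    have "(\<Sum>\<chi>\<in>colourings n. if V \<in> mono_copies n \<chi> c H then ?w \<chi> else 0)
        \<le> (\<Sum>\<chi>\<in>colourings n. if \<forall>e\<in>?F. \<chi> e = c then ?w \<chi> else 0)"
    proof (rule sum_mono)
      fix \<chi>
      show "(if V \<in> mono_copies n \<chi> c H then ?w \<chi> else 0)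
          \<le> (if \<forall>e\<in>?F. \<chi> e = c then ?w \<chi> else 0)"
        using coloured[of \<chi>] random_weight_nonneg[OF p, of n \<chi>] by auto
    qed
    also have "\<dots> = ?q ^ card (oedges H)"
      using random_weight_monochromatic[OF F c] by (simp only: cardF)
    finally show ?thesis .
  qed
  have "(\<Sum>\<chi>\<in>colourings n. ?w \<chi> * real (num_copies n \<chi> c H))
      = (\<Sum>V\<in>?S. \<Sum>\<chi>\<in>colourings n. if V \<in> mono_copies n \<chi> c H then ?w \<chi> else 0)"
    unfolding expand by (rule sum.swap)
  also have "\<dots> \<le> of_nat (card ?S) * ?q ^ card (oedges H)"
    by (rule sum_bounded_above) (rule each)
  finally show ?thesis
    by (simp add: mult.commute)
qed

text \<open>The weights are nonnegative and sum to 1, so the minimum is at most the weighted mean,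
  which the expected counts bound.\<close>

lemma ordered_mult_le_random:
  assumes G: "ordered_graph G" and H: "ordered_graph H"
    and lam: "lam1 \<ge> 0" "lam2 \<ge> 0" and p: "0 \<le> p" "p \<le> 1"
  shows "ordered_mult lam1 lam2 n G H
    \<le> lam1 * p ^ card (oedges G) * real (n choose card (overts G))
      + lam2 * (1 - p) ^ card (oedges H) * real (n choose card (overts H))"
proof -
  let ?w = "random_weight p n"
  have "ordered_mult lam1 lam2 n G H = (\<Sum>\<chi>\<in>colourings n. ?w \<chi> * ordered_mult lam1 lam2 n G H)"
    by (simp add: sum_random_weight flip: sum_distrib_right)
  also have "\<dots> \<le> (\<Sum>\<chi>\<in>colourings n. ?w \<chi> *
      (lam1 * real (num_copies n \<chi> 1 G) + lam2 * real (num_copies n \<chi> 2 H)))"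
    by (intro sum_mono mult_left_mono ordered_mult_le random_weight_nonneg p)
  also have "\<dots> = lam1 * (\<Sum>\<chi>\<in>colourings n. ?w \<chi> * real (num_copies n \<chi> 1 G))
      + lam2 * (\<Sum>\<chi>\<in>colourings n. ?w \<chi> * real (num_copies n \<chi> 2 H))"
    by (simp add: sum_distrib_left sum.distrib algebra_simps)
  also have "\<dots> \<le> lam1 * (p ^ card (oedges G) * real (n choose card (overts G)))
      + lam2 * ((1 - p) ^ card (oedges H) * real (n choose card (overts H)))"
    using expected_num_copies_le[OF G _ p, of 1 n] expected_num_copies_le[OF H _ p, of 2 n] lam
    by (intro add_mono mult_left_mono) auto
  finally show ?thesis
    by (simp only: mult.assoc)
qed

section \<open>Specialisation to ordered stars\<close>

lemma card_overts_ordered_star: "card (overts (ordered_star r s)) = r + s - 1"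
  by (simp add: ordered_star_def)

text \<open>Edges correspond to leaves. The centre \<open>r\<close> lies in
  \<open>{1..r + s - 1}\<close> because \<open>r\<close> and \<open>s\<close> are at least 1, so
  removing it leaves \<open>r + s - 2\<close> leaves.\<close>

lemma card_oedges_ordered_star:
  assumes "r \<ge> 1" "s \<ge> 1"
  shows "card (oedges (ordered_star r s)) = r + s - 2"
proof -
  have "oedges (ordered_star r s) = (\<lambda>j. {r, j}) ` ({1..r + s - 1} - {r})"
    by (auto simp: ordered_star_def)
  moreover have "inj_on (\<lambda>j. {r, j}) ({1..r + s - 1} - {r})"
    by (auto simp: inj_on_def doubleton_eq_iff)
  ultimately show ?thesis
    using assms by (simp add: card_image)
qed

theorem theorem3p1:
  fixes r1 s1 r2 s2 h e1 e2 R :: nat and lam1 lam2 :: real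
  assumes "r1 \<ge> 2" and "s1 \<ge> 2" and "r2 \<ge> 2" and "s2 \<ge> 2"
    and "lam1 > 0" and "lam2 > 0"
    and "h = min (r1 + s1 - 1) (r2 + s2 - 1)"
    and "e1 = r1 + s1 - 2" and "e2 = r2 + s2 - 2"
    and "R = ordered_ramsey (ordered_star r1 s1) (ordered_star r2 s2)"
  shows
    "(\<forall>t n. R \<le> t \<and> t \<le> n \<longrightarrow>
        ordered_mult lam1 lam2 n (ordered_star r1 s1) (ordered_star r2 s2)
          \<ge> ordered_mult lam1 lam2 t (ordered_star r1 s1) (ordered_star r2 s2)
              * (real (n choose h) / real (t choose h)))
   \<and> (\<forall>n. ordered_mult lam1 lam2 n (ordered_star r1 s1) (ordered_star r2 s2)
          \<le> (INF p\<in>{0..1::real}. lam1 * p ^ e1 * real (n choose (r1 + s1 - 1))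
                + lam2 * (1 - p) ^ e2 * real (n choose (r2 + s2 - 1))))
   \<and> (\<forall>t n. R \<le> t \<and> t \<le> n \<and> max (r1 + s1 - 1) (r2 + s2 - 1) \<le> t \<longrightarrow>
        (\<forall>\<chi>\<in>colourings n.
           real (num_copies n \<chi> 1 (ordered_star r1 s1))
             \<ge> ordered_mult lam1 lam2 t (ordered_star r1 s1) (ordered_star r2 s2) / (2 * lam1)
                 * (real (n choose (r1 + s1 - 1)) / real (t choose (r1 + s1 - 1)))
         \<or> real (num_copies n \<chi> 2 (ordered_star r2 s2))
             \<ge> ordered_mult lam1 lam2 t (ordered_star r1 s1) (ordered_star r2 s2) / (2 * lam2)
                 * (real (n choose (r2 + s2 - 1)) / real (t choose (r2 + s2 - 1)))))"
proof -
  let ?G = "ordered_star r1 s1" and ?H = "ordered_star r2 s2"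
  have graphs: "ordered_graph ?G" "ordered_graph ?H"
    using assms by (auto intro: ordered_graph_star)
  then have fin: "finite (overts ?G)" "finite (overts ?H)"
    by (simp_all add: ordered_graph_def)
  have edges: "card (oedges ?G) = e1" "card (oedges ?H) = e2"
    using assms by (simp_all add: card_oedges_ordered_star)
  note star_simps = card_overts_ordered_star edges
  show ?thesis
  proof (intro conjI allI impI ballI)
    fix t n
    assume "R \<le> t \<and> t \<le> n"
    then show "ordered_mult lam1 lam2 n ?G ?H
        \<ge> ordered_mult lam1 lam2 t ?G ?H * (real (n choose h) / real (t choose h))"
      using assms by (intro ordered_mult_growth fin) (auto simp: star_simps)
  next
    fix n
    show "ordered_mult lam1 lam2 n ?G ?H
        \<le> (INF p\<in>{0..1::real}. lam1 * p ^ e1 * real (n choose (r1 + s1 - 1))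
              + lam2 * (1 - p) ^ e2 * real (n choose (r2 + s2 - 1)))"
    \<comment> \<open>It suffices to bound the value at each \<open>p\<close>, the interval being
      nonempty. The function is continuous on a compact interval, so its infimum is the
      minimum.\<close>
    proof (rule cINF_greatest)
      fix p :: real
      assume "p \<in> {0..1}"
      then show "ordered_mult lam1 lam2 n ?G ?H
          \<le> lam1 * p ^ e1 * real (n choose (r1 + s1 - 1))
            + lam2 * (1 - p) ^ e2 * real (n choose (r2 + s2 - 1))"
        using ordered_mult_le_random[OF graphs, of lam1 lam2 p n] assms(5,6)
        by (simp add: star_simps)
    qed simp
  next
    fix t n \<chi>
    assume "R \<le> t \<and> t \<le> n \<and> max (r1 + s1 - 1) (r2 + s2 - 1) \<le> t" "\<chi> \<in> colourings n"
    then show "real (num_copies n \<chi> 1 ?G)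
          \<ge> ordered_mult lam1 lam2 t ?G ?H / (2 * lam1)
              * (real (n choose (r1 + s1 - 1)) / real (t choose (r1 + s1 - 1)))
        \<or> real (num_copies n \<chi> 2 ?H)
          \<ge> ordered_mult lam1 lam2 t ?G ?H / (2 * lam2)
              * (real (n choose (r2 + s2 - 1)) / real (t choose (r2 + s2 - 1)))"
      using many_copies_in_one_colour[OF fin assms(5,6), of t n \<chi>] by (simp add: star_simps)
  qed
qed

end
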